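(* Let $S_0>0$, $\sigma>0$ and let $\mathcal{I}(K,S_0)=\sup_{\theta\in\mathbb{R}}\{\theta K-\Lambda(\theta)\}$, $K>0$, be the rate function for Asian options in the square-root model ($\beta=\frac12$), with $\Lambda$ as given in the context. (i) (Large strike, out-of-the-money Asian calls, $K>S_0$.) $$\lim_{K\to\infty}\frac{\mathcal{I}(K,S_0)}{K}=\frac{\pi^2}{2\sigma^2}.$$ (ii) (Small strike, out-of-the-money Asian puts, $K<S_0$.) $$\mathcal{I}(K,S_0)\sim\frac{S_0^2}{2\sigma^2K}\qquad\text{as }K\to0.$$
   Context: The function $\Lambda:\mathbb{R}\to(-\infty,+\infty]$ is $$\Lambda(\theta)=\begin{cases}\frac{\sqrt{2\theta}}{\sigma}\tan\left(\frac{\sigma}{2}\sqrt{2\theta}\right)S_0 & \text{if } 0\le\theta<\frac{\pi^2}{2\sigma^2},\\ -\frac{\sqrt{-2\theta}}{\sigma}\tanh\left(\frac{\sigma}{2}\sqrt{-2\theta}\right)S_0 & \text{if }\theta\le0,\\ +\infty & \text{otherwise.}\end{cases}$$ $\mathcal{I}(\cdot,S_0)$ is the large deviation rate function as $T\to0$ of $\frac1T\int_0^TS_t\,dt$ when $dS_t=(r-q)S_t\,dt+\sigma\sqrt{S_t}\,dW_t$. The notation $f\sim g$ means $f/g\to1$. *)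

theory Defs
  imports Complex_Main "HOL-Library.Extended_Real"
begin

definition Lambda :: "real \<Rightarrow> real \<Rightarrow> real \<Rightarrow> ereal" where
  "Lambda \<sigma> S0 \<theta> =
    (if 0 \<le> \<theta> \<and> \<theta> < pi\<^sup>2 / (2 * \<sigma>\<^sup>2)
     then ereal (sqrt (2 * \<theta>) / \<sigma> * tan (\<sigma> / 2 * sqrt (2 * \<theta>)) * S0)
     else if \<theta> \<le> 0
     then ereal (- (sqrt (- 2 * \<theta>) / \<sigma>) * tanh (\<sigma> / 2 * sqrt (- 2 * \<theta>)) * S0)
     else \<infinity>)"

(* The supremum is taken in the extended reals; values of theta with Lambda = \<infinity>
   contribute -\<infinity> and finiteness of the rate function is not presupposed. *)
definition rate_function :: "real \<Rightarrow> real \<Rightarrow> real \<Rightarrow> ereal" where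
  "rate_function \<sigma> K S0 = (SUP \<theta>. ereal (\<theta> * K) - Lambda \<sigma> S0 \<theta>)"

end

theory Submission
  imports Defs
begin

text \<open>
  Both limits follow from one two-sided estimate. Since the tangent is nonnegative on
  \<open>[0, \<pi>/2)\<close>, the exponents \<open>\<theta> \<ge> 0\<close> contribute at most \<open>K \<pi>\<^sup>2 / (2 \<sigma>\<^sup>2)\<close> to the supremum; since
  \<open>tanh \<le> 1\<close>, the exponents \<open>\<theta> = - s\<^sup>2 / 2\<close> contribute at most
  \<open>- K s\<^sup>2 / 2 + s S\<^sub>0 / \<sigma> \<le> S\<^sub>0\<^sup>2 / (2 \<sigma>\<^sup>2 K)\<close>. The first bound dominates for large \<open>K\<close>, the second for
  small \<open>K\<close>. Conversely, a fixed \<open>\<theta>\<close> close to \<open>\<pi>\<^sup>2 / (2 \<sigma>\<^sup>2)\<close> is asymptotically optimal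
  for \<open>K \<rightarrow> \<infinity>\<close>, and \<open>s = S\<^sub>0 / (\<sigma> K)\<close> is so for \<open>K \<rightarrow> 0\<close>.
\<close>

lemma Lambda_nonneg:
  assumes "S0 > 0" "\<sigma> > 0" "0 \<le> \<theta>"
  shows "0 \<le> Lambda \<sigma> S0 \<theta>"
proof (cases "\<theta> < pi\<^sup>2 / (2 * \<sigma>\<^sup>2)")
  case True
  \<comment> \<open>The cutoff on \<theta> is exactly what keeps the argument of \<open>tan\<close>
    below \<pi>/2, before its first pole.\<close>
  then have "2 * \<theta> < (pi / \<sigma>)\<^sup>2"
    using assms by (simp add: field_simps power2_eq_square)
  then have "sqrt (2 * \<theta>) < pi / \<sigma>"
    using assms by (intro real_less_lsqrt) auto
  then have "\<sigma> / 2 * sqrt (2 * \<theta>) < pi / 2"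
    using assms by (simp add: field_simps)
  then have "0 \<le> tan (\<sigma> / 2 * sqrt (2 * \<theta>))"
    using assms tan_pos_pi2_le by simp
  then show ?thesis
    using assms True by (simp add: Lambda_def)
next
  case False
  have "0 < pi\<^sup>2 / (2 * \<sigma>\<^sup>2)"
    using assms by simp
  with False show ?thesis
    using assms by (auto simp: Lambda_def)
qed

text \<open>Substituting \<open>s\<close> for \<open>sqrt (- 2 * \<theta>)\<close> removes the root,
  so that the exponent becomes quadratic in \<open>s\<close> once \<open>tanh\<close> is bounded by
  1.\<close>

lemma Lambda_neg:
  assumes "0 < s"
  shows "Lambda \<sigma> S0 (- (s\<^sup>2 / 2)) = ereal (- (s / \<sigma>) * tanh (\<sigma> / 2 * s) * S0)"
  using assms by (simp add: Lambda_def real_sqrt_unique)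

lemma rate_function_ge: "ereal (\<theta> * K) - Lambda \<sigma> S0 \<theta> \<le> rate_function \<sigma> K S0"
  unfolding rate_function_def by (rule SUP_upper) simp

lemma rate_function_le:
  assumes "S0 > 0" "\<sigma> > 0" "K > 0"
  shows "rate_function \<sigma> K S0 \<le> ereal (max (pi\<^sup>2 / (2 * \<sigma>\<^sup>2) * K) (S0\<^sup>2 / (2 * \<sigma>\<^sup>2 * K)))"
  unfolding rate_function_def
proof (rule SUP_least)
  fix \<theta> :: real
  let ?c = "pi\<^sup>2 / (2 * \<sigma>\<^sup>2)" and ?M = "S0\<^sup>2 / (2 * \<sigma>\<^sup>2 * K)"
  consider "\<theta> < 0" | "0 \<le> \<theta>" "\<theta> < ?c" | "0 \<le> \<theta>" "?c \<le> \<theta>"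
    by linarith
  then show "ereal (\<theta> * K) - Lambda \<sigma> S0 \<theta> \<le> ereal (max (?c * K) ?M)"
  proof cases
    case 1
    define s where "s = sqrt (- 2 * \<theta>)"
    have s: "0 < s" "\<theta> = - (s\<^sup>2 / 2)"
      using 1 by (simp_all add: s_def)
    have "s / \<sigma> * tanh (\<sigma> / 2 * s) * S0 \<le> s / \<sigma> * 1 * S0"
      using s assms tanh_real_lt_1[of "\<sigma> / 2 * s"]
      by (intro mult_right_mono mult_left_mono) auto
    \<comment> \<open>Completing the square in \<open>s\<close>: \<open>?M\<close> is the maximum of
      the concave quadratic, attained at \<open>s = S0 / (\<sigma> * K)\<close>.\<close>
    moreover have "?M - (- (s\<^sup>2 / 2) * K + s / \<sigma> * S0) = K / 2 * (s - S0 / (\<sigma> * K))\<^sup>2"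
      using assms by (simp add: field_simps power2_eq_square)
    moreover have "0 \<le> K / 2 * (s - S0 / (\<sigma> * K))\<^sup>2"
      using assms by simp
    ultimately have "- (s\<^sup>2 / 2) * K + s / \<sigma> * tanh (\<sigma> / 2 * s) * S0 \<le> ?M"
      by linarith
    then show ?thesis
      unfolding s(2) Lambda_neg[OF s(1)] by (simp add: le_max_iff_disj)
  next
    case 2
    have "ereal (\<theta> * K) - Lambda \<sigma> S0 \<theta> \<le> ereal (\<theta> * K) - 0"
      by (intro ereal_minus_mono Lambda_nonneg order_refl assms 2)
    also have "\<dots> \<le> ereal (?c * K)"
      using 2 assms by (simp add: mult_right_mono del: times_divide_eq_left)
    finally show ?thesis
      by (rule order_trans) simp
  next
    case 3
    \<comment> \<open>Positivity of \<open>?c\<close> rules out the \<open>tanh\<close> branch, so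
      \<open>Lambda\<close> is infinite and the difference is -\<infinity>.\<close>
    have "0 < ?c"
      using assms by simp
    with 3 show ?thesis
      by (simp add: Lambda_def)
  qed
qed

lemma rate_function_large_strike:
  assumes "S0 > 0" "\<sigma> > 0"
  shows "((\<lambda>K. rate_function \<sigma> K S0 / ereal K) \<longlongrightarrow> ereal (pi\<^sup>2 / (2 * \<sigma>\<^sup>2))) at_top"
proof (rule order_tendstoI)
  let ?c = "pi\<^sup>2 / (2 * \<sigma>\<^sup>2)"
  have "0 < ?c"
    using assms by simp
  fix a assume "a < ereal ?c"
  \<comment> \<open>The maximum with 0 forces the chosen \<theta> to be positive, where
    \<open>Lambda\<close> has a finite value \<open>L\<close>; as \<open>L\<close> does not depend
    on \<open>K\<close>, its share \<open>L / K\<close> vanishes.\<close>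
  then have "max a 0 < ereal ?c"
    using \<open>0 < ?c\<close> by simp
  then obtain \<theta> where "max a 0 < ereal \<theta>" "ereal \<theta> < ereal ?c"
    using ereal_dense2 by blast
  then have \<theta>: "a < ereal \<theta>" "0 < \<theta>" "\<theta> < ?c"
    by simp_all
  then obtain L where L: "Lambda \<sigma> S0 \<theta> = ereal L"
    by (simp add: Lambda_def)
  have "((\<lambda>K. \<theta> - L / K) \<longlongrightarrow> \<theta> - 0) at_top"
    by (intro tendsto_diff tendsto_const real_tendsto_divide_at_top[OF tendsto_const filterlim_ident])
  then have "((\<lambda>K. ereal (\<theta> - L / K)) \<longlongrightarrow> ereal \<theta>) at_top"
    by simp
  then have "eventually (\<lambda>K. a < ereal (\<theta> - L / K)) at_top"
    using \<theta>(1) by (rule order_tendstoD)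
  then show "eventually (\<lambda>K. a < rate_function \<sigma> K S0 / ereal K) at_top"
    using eventually_gt_at_top[of 0]
  proof eventually_elim
    case (elim K)
    have "ereal (\<theta> - L / K) = (ereal (\<theta> * K) - Lambda \<sigma> S0 \<theta>) / ereal K"
      using elim by (simp add: L field_simps)
    also have "\<dots> \<le> rate_function \<sigma> K S0 / ereal K"
      using elim by (intro ereal_divide_right_mono rate_function_ge) simp
    finally show ?case
      using elim by order
  qed
next
  let ?c = "pi\<^sup>2 / (2 * \<sigma>\<^sup>2)"
  fix a assume a: "ereal ?c < a"
  \<comment> \<open>The two bounds in \<open>rate_function_le\<close> cross where
    \<open>pi * K = S0\<close>; from there on the linear one is the larger.\<close>
  show "eventually (\<lambda>K. rate_function \<sigma> K S0 / ereal K < a) at_top"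
    using eventually_ge_at_top[of "S0 / pi"]
  proof eventually_elim
    case (elim K)
    have "0 < S0 / pi"
      using assms by simp
    then have "0 < K"
      using elim by linarith
    have "S0\<^sup>2 \<le> (pi * K)\<^sup>2"
      using elim assms by (intro power_mono) (auto simp: field_simps)
    then have "S0\<^sup>2 / (2 * \<sigma>\<^sup>2 * K) \<le> ?c * K"
      using \<open>0 < K\<close> assms by (simp add: field_simps power2_eq_square)
    then have "rate_function \<sigma> K S0 \<le> ereal (?c * K)"
      using rate_function_le[OF assms \<open>0 < K\<close>] by (simp add: max_absorb1)
    then have "rate_function \<sigma> K S0 / ereal K \<le> ereal (?c * K) / ereal K"
      using \<open>0 < K\<close> by (intro ereal_divide_right_mono) auto
    also have "\<dots> = ereal ?c"
      using \<open>0 < K\<close> by simp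
    finally show ?case
      using a by order
  qed
qed

lemma rate_function_small_strike:
  assumes "S0 > 0" "\<sigma> > 0"
  shows "((\<lambda>K. rate_function \<sigma> K S0 / ereal (S0\<^sup>2 / (2 * \<sigma>\<^sup>2 * K))) \<longlongrightarrow> 1) (at_right 0)"
proof (rule tendsto_sandwich)
  let ?M = "\<lambda>K. S0\<^sup>2 / (2 * \<sigma>\<^sup>2 * K)"
  have "filterlim (\<lambda>K. S0 / 2 * inverse K) at_top (at_right 0)"
    using assms
    by (intro filterlim_tendsto_pos_mult_at_top[OF tendsto_const] filterlim_inverse_at_top_right) simp
  then have "((\<lambda>K. tanh (S0 / 2 * inverse K)) \<longlongrightarrow> 1) (at_right 0)"
    by (rule filterlim_compose[OF tanh_real_at_top])
  then have "((\<lambda>K. 2 * tanh (S0 / 2 * inverse K) - 1) \<longlongrightarrow> 2 * 1 - 1) (at_right 0)"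
    by (intro tendsto_intros)
  then show "((\<lambda>K. ereal (2 * tanh (S0 / 2 * inverse K) - 1)) \<longlongrightarrow> 1) (at_right 0)"
    by (simp add: one_ereal_def)
  show "eventually (\<lambda>K. ereal (2 * tanh (S0 / 2 * inverse K) - 1)
      \<le> rate_function \<sigma> K S0 / ereal (?M K)) (at_right 0)"
    using eventually_at_right_less[of 0]
  proof eventually_elim
    case (elim K)
    let ?t = "tanh (S0 / 2 * inverse K)"
    \<comment> \<open>This is the maximiser of the quadratic upper bound; the argument of
      \<open>tanh\<close> becomes \<open>S0 / (2 * K)\<close>, which tends to infinity.\<close>
    define s where "s = S0 / (\<sigma> * K)"
    have "0 < s" "0 < ?M K"
      using assms elim by (simp_all add: s_def)
    have "\<sigma> / 2 * s = S0 / 2 * inverse K"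
      using assms elim by (simp add: s_def field_simps)
    then have "ereal (- (s\<^sup>2 / 2) * K) - Lambda \<sigma> S0 (- (s\<^sup>2 / 2))
        = ereal (- (s\<^sup>2 / 2) * K + s / \<sigma> * ?t * S0)"
      by (simp add: Lambda_neg[OF \<open>0 < s\<close>])
    \<comment> \<open>At this \<open>s\<close> the quadratic term equals \<open>- ?M K\<close> and
      the linear one \<open>2 * ?t * ?M K\<close>.\<close>
    also have "- (s\<^sup>2 / 2) * K + s / \<sigma> * ?t * S0 = (2 * ?t - 1) * ?M K"
      using assms elim by (simp add: s_def field_simps power2_eq_square)
    finally have "ereal ((2 * ?t - 1) * ?M K) \<le> rate_function \<sigma> K S0"
      using rate_function_ge[of "- (s\<^sup>2 / 2)" K \<sigma> S0] by simp
    then have "ereal ((2 * ?t - 1) * ?M K) / ereal (?M K) \<le> rate_function \<sigma> K S0 / ereal (?M K)"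
      using \<open>0 < ?M K\<close> by (intro ereal_divide_right_mono) auto
    moreover have "ereal ((2 * ?t - 1) * ?M K) / ereal (?M K) = ereal (2 * ?t - 1)"
      using assms elim by simp
    ultimately show ?case
      by simp
  qed
  have "0 < S0 / pi"
    using assms by simp
  \<comment> \<open>Below the crossing point \<open>S0 / pi\<close> the bound from negative
    exponents is the larger one.\<close>
  then have "eventually (\<lambda>K. K \<in> {0<..<S0 / pi}) (at_right 0)"
    by (rule eventually_at_right_real)
  then show "eventually (\<lambda>K. rate_function \<sigma> K S0 / ereal (?M K) \<le> 1) (at_right 0)"
  proof eventually_elim
    case (elim K)
    then have "0 < K" "0 < ?M K"
      using assms by simp_all
    have "(pi * K)\<^sup>2 \<le> S0\<^sup>2"
      using elim by (intro power_mono) (auto simp: field_simps)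
    then have "pi\<^sup>2 / (2 * \<sigma>\<^sup>2) * K \<le> ?M K"
      using \<open>0 < K\<close> assms by (simp add: field_simps power2_eq_square)
    then have "rate_function \<sigma> K S0 \<le> ereal (?M K)"
      using rate_function_le[OF assms \<open>0 < K\<close>] by (simp add: max_absorb2)
    then have "rate_function \<sigma> K S0 / ereal (?M K) \<le> ereal (?M K) / ereal (?M K)"
      using \<open>0 < ?M K\<close> by (intro ereal_divide_right_mono) auto
    also have "\<dots> = 1"
      using assms \<open>0 < K\<close> by (simp add: one_ereal_def)
    finally show ?case .
  qed
  show "((\<lambda>_. 1 :: ereal) \<longlongrightarrow> 1) (at_right 0)"
    by simp
qed

theorem proposition3:
  fixes \<sigma> S0 :: real
  assumes "S0 > 0" and "\<sigma> > 0"
  shows "((\<lambda>K. rate_function \<sigma> K S0 / ereal K) \<longlongrightarrow> ereal (pi\<^sup>2 / (2 * \<sigma>\<^sup>2))) at_top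
    \<and> ((\<lambda>K. rate_function \<sigma> K S0 / ereal (S0\<^sup>2 / (2 * \<sigma>\<^sup>2 * K))) \<longlongrightarrow> 1) (at_right 0)"
  using rate_function_large_strike[OF assms] rate_function_small_strike[OF assms] by blast

end
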